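(* Let $\beta=2$, and let $(z_1,\ldots,z_n)$ be a random vector of $\mathbb{C}^n$ with density proportional to $$(z_1,\ldots,z_n)\mapsto \prod_{j=1}^n e^{-nV(|z_j|)}\prod_{1\le j<k\le n}|z_j-z_k|^2 .$$ Let $|z|_{(1)}\ge\cdots\ge|z|_{(n)}$ be the decreasing reordering of the moduli $|z_1|,\ldots,|z_n|$. Let $R_1,\ldots,R_n$ be independent random variables such that, for every $1\le k\le n$, $R_k$ has density proportional to $$t\mapsto t^{2k-1}e^{-nV(t)}\mathbf{1}_{[0,\infty)}(t),$$ and let $R_{(1)}\ge\cdots\ge R_{(n)}$ be their decreasing reordering. Then we have the identity in distribution $$(|z|_{(1)},\ldots,|z|_{(n)})\overset{d}{=}(R_{(1)},\ldots,R_{(n)}).$$ In other words, in terms of point processes, $\sum_{k=1}^n\delta_{|z_k|}\overset{d}{=}\sum_{k=1}^n\delta_{R_k}$.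
   Context: Densities on $\mathbb{C}^n$ are with respect to Lebesgue measure on $\mathbb{C}^n\cong\mathbb{R}^{2n}$. Standing assumptions on the potential (with $\beta=2$): $V:\mathbb{R}_+\to\mathbb{R}$ is smooth, $Q(z)=V(|z|)$ is a smooth function on $\mathbb{C}$, either $r\mapsto rV'(r)$ is increasing or $V$ is convex, $r^{2}e^{-V(r)}\to0$ as $r\to\infty$, and there is a real $\beta'>2$ such that $\sup_{z\in\mathbb{C}}(1+|z|)^{\beta'}e^{-V(|z|)}<\infty$. This ensures that the unnormalized density on $\mathbb{C}^n$ is integrable for $n$ large enough; $n$ is such that it is integrable. *)

theory Defs
  imports "HOL-Probability.Probability"
begin

text \<open>
  \<open>Ck_on k S f\<close>: \<open>f\<close> is \<open>k\<close> times continuously (real) differentiable on \<open>S\<close>, by iterating directional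
  derivatives. Derivatives are relative to \<open>S\<close>: one-sided at \<open>0\<close> for \<open>S = {0..}\<close>, full real
  Frechet derivatives for \<open>S = UNIV :: complex set\<close>. In both cases they are unique.
\<close>

primrec Ck_on ::
  "nat \<Rightarrow> 'a::euclidean_space set \<Rightarrow> ('a \<Rightarrow> 'b::real_normed_vector) \<Rightarrow> bool" where
  "Ck_on 0 S f \<longleftrightarrow> continuous_on S f"
| "Ck_on (Suc k) S f \<longleftrightarrow>
     (\<exists>f'. (\<forall>x\<in>S. (f has_derivative f' x) (at x within S)) \<and> (\<forall>h. Ck_on k S (\<lambda>x. f' x h)))"

definition smooth_on :: "'a::euclidean_space set \<Rightarrow> ('a \<Rightarrow> 'b::real_normed_vector) \<Rightarrow> bool" where
  "smooth_on S f \<longleftrightarrow> (\<forall>k. Ck_on k S f)"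

definition has_density_prop_to ::
  "'w measure \<Rightarrow> 'a measure \<Rightarrow> ('w \<Rightarrow> 'a) \<Rightarrow> ('a \<Rightarrow> real) \<Rightarrow> bool" where
  "has_density_prop_to P L X f \<longleftrightarrow> (\<exists>c>0. distributed P L X (\<lambda>x. ennreal (c * f x)))"

text \<open>Measurability is included because \<open>distr\<close> is only meaningful for measurable maps.\<close>

definition eq_in_distr ::
  "'v measure \<Rightarrow> 'w measure \<Rightarrow> 'a measure \<Rightarrow> ('v \<Rightarrow> 'a) \<Rightarrow> ('w \<Rightarrow> 'a) \<Rightarrow> bool" where
  "eq_in_distr P P' S X Y \<longleftrightarrow>
     X \<in> measurable P S \<and> Y \<in> measurable P' S \<and> distr P S X = distr P' S Y"

definition gas_weight :: "(real \<Rightarrow> real) \<Rightarrow> nat \<Rightarrow> (nat \<Rightarrow> complex) \<Rightarrow> real" where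
  "gas_weight V n z =
     (\<Prod>j=1..n. exp (- real n * V (cmod (z j)))) *
     (\<Prod>(j, k)\<in>{(j, k). 1 \<le> j \<and> j < k \<and> k \<le> n}. (cmod (z j - z k))\<^sup>2)"

definition radial_weight :: "(real \<Rightarrow> real) \<Rightarrow> nat \<Rightarrow> nat \<Rightarrow> real \<Rightarrow> real" where
  "radial_weight V n k t = t ^ (2 * k - 1) * exp (- real n * V t) * indicat_real {0..} t"

text \<open>
  The vector \<open>(x\<^bsub>(1)\<^esub>, \<dots>, x\<^bsub>(n)\<^esub>)\<close> with \<open>x\<^bsub>(1)\<^esub> \<ge> \<dots> \<ge> x\<^bsub>(n)\<^esub>\<close>, repetitions kept, as an
  element of the product space over \<open>{1..n}\<close> (hence the restriction).
\<close>

definition decreasing_reordering :: "nat \<Rightarrow> (nat \<Rightarrow> real) \<Rightarrow> nat \<Rightarrow> real" where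
  "decreasing_reordering n x =
     (\<lambda>k\<in>{1..n}. rev (sort (map x [1..<Suc n])) ! (k - 1))"

definition dirac_sum :: "nat \<Rightarrow> (nat \<Rightarrow> real) \<Rightarrow> real measure" where
  "dirac_sum n x =
     measure_of UNIV (sets borel) (\<lambda>A. \<Sum>k=1..n. emeasure (return borel (x k)) A)"

lemma emeasure_dirac_sum:
  assumes "A \<in> sets borel"
  shows "emeasure (dirac_sum n x) A = (\<Sum>k=1..n. emeasure (return borel (x k)) A)"
  unfolding dirac_sum_def
proof (rule emeasure_measure_of_sigma)
  show "sigma_algebra UNIV (sets (borel :: real measure))"
    using sets.sigma_algebra_axioms[of "borel :: real measure"] by simp
  show "positive (sets borel) (\<lambda>A. \<Sum>k=1..n. emeasure (return borel (x k)) A)"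
    by (simp add: positive_def)
  show "countably_additive (sets borel) (\<lambda>A. \<Sum>k=1..n. emeasure (return borel (x k)) A)"
  proof (rule countably_additiveI)
    fix F :: "nat \<Rightarrow> real set"
    assume F: "range F \<subseteq> sets borel" "disjoint_family F"
    have "(\<Sum>i. \<Sum>k=1..n. emeasure (return borel (x k)) (F i)) =
          (\<Sum>k=1..n. \<Sum>i. emeasure (return borel (x k)) (F i))"
      by (rule suminf_sum) simp
    also have "\<dots> = (\<Sum>k=1..n. emeasure (return borel (x k)) (\<Union>i. F i))"
      using F by (intro sum.cong refl suminf_emeasure) auto
    finally show "(\<Sum>i. \<Sum>k=1..n. emeasure (return borel (x k)) (F i)) =
          (\<Sum>k=1..n. emeasure (return borel (x k)) (\<Union>i. F i))" .
  qed
  show "A \<in> sets borel" by fact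
qed

text \<open>
  The space of measures on \<open>K\<close> with the \<open>\<sigma>\<close>-algebra generated by the evaluations \<open>\<mu> \<mapsto> \<mu> A\<close>;
  point processes are random elements of it. (The library's \<open>subprob_algebra\<close> is the analogue for
  measures of total mass at most \<open>1\<close>.)
\<close>

definition measure_algebra :: "'a measure \<Rightarrow> 'a measure measure" where
  "measure_algebra K = sigma {\<mu>. sets \<mu> = sets K}
     {{\<mu>. sets \<mu> = sets K \<and> emeasure \<mu> A \<in> B} | A B. A \<in> sets K \<and> B \<in> sets borel}"

end

theory Submission
  imports Defs "Jordan_Normal_Form.Determinant"
begin

text \<open>
  The joint law of the moduli does not change when the density is averaged over rotations of the
  individual \<open>z\<^sub>j\<close>, since these preserve Lebesgue measure. Writing the Vandermonde product as a sum
  over permutations, the cross terms \<open>\<sigma> \<noteq> \<tau>\<close> of its squared modulus have mean zero, and only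
  \<open>\<Sum>\<^sub>\<sigma> \<Prod>\<^sub>j |z\<^sub>j|\<^bsup>2 \<sigma>(j)\<^esup> exp (-n V(|z\<^sub>j|))\<close> survives. The exponents are smaller than \<open>n\<close>, so it is enough
  to average over \<open>n\<close>-th roots of unity, which keeps everything a finite sum. Since
  \<open>z \<mapsto> |z|\<close> sends Lebesgue measure to \<open>2\<pi>r dr\<close>, each summand is a multiple of the law of
  \<open>(R\<^bsub>\<sigma>(1)+1\<^esub>, \<dots>, R\<^bsub>\<sigma>(n)+1\<^esub>)\<close>, and symmetric functionals do not see \<open>\<sigma>\<close>.
\<close>

section \<open>The Vandermonde determinant averaged over roots of unity\<close>

text \<open>Induction on the number of nodes: replacing the last node by a variable turns the
  determinant into a polynomial of degree at most \<open>n\<close> that vanishes at the other nodes,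
  with the smaller determinant as its top coefficient.\<close>

lemma det_vandermonde:
  fixes z :: "nat \<Rightarrow> 'a::idom"
  shows "det (mat n n (\<lambda>(i, j). z i ^ j)) = (\<Prod>j<n. \<Prod>i<j. z j - z i)"
proof (induction n)
  case 0
  show ?case by (simp add: det_def)
next
  case (Suc n)
  define A where "A x = mat (Suc n) (Suc n) (\<lambda>(i, j). (z(n := x)) i ^ j)" for x
  \<comment> \<open>\<open>C j\<close> is the cofactor of the entry in row \<open>n\<close> and
    column \<open>j\<close>. Row \<open>n\<close> alone contains \<open>x\<close>, so
    \<open>C j\<close> does not depend on \<open>x\<close>.\<close>
  define C where "C j = (-1) ^ (n + j) * det (mat n n (\<lambda>(i, j'). z i ^ (if j' < j then j' else Suc j')))" for j
  define p where "p = (\<Sum>j<Suc n. monom (C j) j)"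
  define q where "q = Polynomial.smult (C n) (\<Prod>i<n. [:- z i, 1:])"
  have carr: "A x \<in> carrier_mat (Suc n) (Suc n)" for x
    by (simp add: A_def)
  have del: "mat_delete (A x) n j = mat n n (\<lambda>(i, j'). z i ^ (if j' < j then j' else Suc j'))" for x j
    by (rule eq_matI) (auto simp: mat_delete_def A_def)
  have A_nth: "A x $$ (n, j) = x ^ j" if "j < Suc n" for x j
    using that by (simp add: A_def)
  have poly_p: "poly p x = det (A x)" for x
  proof -
    have "det (A x) = (\<Sum>j<Suc n. A x $$ (n, j) * cofactor (A x) n j)"
      by (rule laplace_expansion_row[OF carr]) simp
    also have "\<dots> = (\<Sum>j<Suc n. x ^ j * C j)"
      by (intro sum.cong refl) (simp add: cofactor_def del C_def A_nth)
    finally show ?thesis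
      by (simp add: p_def poly_sum poly_monom mult.commute)
  qed
  have "mat n n (\<lambda>(i, j'). z i ^ (if j' < n then j' else Suc j')) = mat n n (\<lambda>(i, j). z i ^ j)"
    by (rule eq_matI) auto
  then have Cn: "C n = (\<Prod>j<n. \<Prod>i<j. z j - z i)"
    using Suc.IH by (simp add: C_def flip: mult_2)
  have A_zn: "A (z n) = mat (Suc n) (Suc n) (\<lambda>(i, j). z i ^ j)"
    by (simp add: A_def)
  show ?case
  proof (cases "inj_on z {..<n}")
    case True
    \<comment> \<open>With degrees at most \<open>n\<close> and equal coefficients at
      \<open>n\<close>, the difference has degree below \<open>n\<close> or is zero; agreement at
      \<open>n\<close> distinct nodes forces the latter.\<close>
    have "p = q"
    proof (rule poly_eqI_degree_lead_coeff[where A = "z ` {..<n}" and n = n])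
      show "n \<le> card (z ` {..<n})" using True by (simp add: card_image)
      show "degree p \<le> n"
        unfolding p_def by (intro degree_sum_le) (auto intro: order.trans[OF degree_monom_le])
      have deg: "degree (\<Prod>i<n. [:- z i, 1:]) = n"
        by (simp add: degree_prod_eq_sum_degree)
      have lead: "Polynomial.coeff (\<Prod>i<n. [:- z i, 1:]) n = 1"
        using Polynomial.lead_coeff_prod[of "\<lambda>i. [:- z i, 1:]" "{..<n}"] deg by simp
      show "degree q \<le> n" using deg by (simp add: q_def)
      show "Polynomial.coeff p n = Polynomial.coeff q n"
        unfolding p_def q_def coeff_smult lead by (simp add: coeff_sum)
      fix x assume "x \<in> z ` {..<n}"
      then obtain i where i: "i < n" "x = z i" by auto
      have "det (A x) = 0"
        by (rule det_identical_rows[OF carr, of i n]) (use i in \<open>auto simp: A_def row_def\<close>)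
      moreover have "poly q x = 0"
        using i by (auto simp: q_def poly_prod)
      ultimately show "poly p x = poly q x" by (simp add: poly_p)
    qed
    then have "det (A (z n)) = poly q (z n)" by (simp flip: poly_p)
    then show ?thesis
      by (simp add: A_zn q_def poly_prod Cn)
  next
    case False
    \<comment> \<open>A repeated node gives two equal rows on the left and a zero factor on the
      right.\<close>
    then obtain i j where ij: "i < j" "j < n" "z i = z j"
      unfolding inj_on_def by (metis lessThan_iff nat_neq_iff)
    have "det (A (z n)) = 0"
      by (rule det_identical_rows[OF carr, of i j]) (use ij in \<open>auto simp: A_def row_def\<close>)
    moreover have "(\<Prod>j<Suc n. \<Prod>i<j. z j - z i) = 0"
    proof -
      have "\<exists>i\<in>{..<j}. z j - z i = 0"
        using ij by (intro bexI[of _ i]) auto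
      then have "(\<Prod>i<j. z j - z i) = 0"
        by (rule prod_zero[OF finite_lessThan])
      then have "\<exists>j\<in>{..<Suc n}. (\<Prod>i<j. z j - z i) = 0"
        using ij by (intro bexI[of _ j]) auto
      then show ?thesis
        by (rule prod_zero[OF finite_lessThan])
    qed
    ultimately show ?thesis by (simp only: A_zn)
  qed
qed

text \<open>The terms form a geometric progression whose ratio \<open>w\<close> is an
  \<open>n\<close>-th root of unity. Since \<open>a\<close> and \<open>b\<close> lie below
  \<open>n\<close>, their difference is divisible by \<open>n\<close> only if they coincide;
  otherwise the ratio is not 1 and the sum vanishes.\<close>

lemma sum_roots_of_unity_cnj:
  fixes a b n :: nat
  assumes "a < n" "b < n"
  shows "(\<Sum>m<n. cis (2 * pi * real m / real n) ^ a * cnj (cis (2 * pi * real m / real n) ^ b)) =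
    (if a = b then of_nat n else 0)"
proof -
  define w where "w = cis (2 * pi * (real a - real b) / real n)"
  have w_pow: "cis (2 * pi * real m / real n) ^ a * cnj (cis (2 * pi * real m / real n) ^ b) = w ^ m" for m
  proof -
    have "cis (2 * pi * real m / real n) ^ a * cnj (cis (2 * pi * real m / real n) ^ b) =
        cis (real a * (2 * pi * real m / real n) - real b * (2 * pi * real m / real n))"
      by (simp add: Complex.DeMoivre cis_cnj cis_mult flip: complex_cnj_power)
    also have "\<dots> = cis (real m * (2 * pi * (real a - real b) / real n))"
      by (rule arg_cong[where f = cis]) (simp add: algebra_simps diff_divide_distrib)
    finally show ?thesis by (simp add: w_def Complex.DeMoivre)
  qed
  have "w = 1 \<longleftrightarrow> a = b"
  proof
    assume "w = 1"
    then obtain k :: int where "2 * pi * (real a - real b) / real n = of_int k * 2 * pi"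
      unfolding w_def cis_conv_exp exp_eq_1 by auto
    then have "2 * pi * (real a - real b) = 2 * pi * (of_int k * real n)"
      using assms by (simp add: field_simps)
    then have "real a - real b = of_int k * real n"
      by (simp only: mult_cancel_left) simp
    then have k: "int a - int b = k * int n"
      by (metis of_int_diff of_int_eq_iff of_int_mult of_int_of_nat_eq)
    then have "int n dvd int a - int b" by simp
    then have "int a mod int n = int b mod int n" by (simp add: mod_eq_dvd_iff)
    then show "a = b" using assms by simp
  qed (simp add: w_def)
  moreover have "w ^ n = 1"
  proof -
    have "w ^ n = cis (2 * pi * of_int (int a - int b))"
      using assms by (simp add: w_def Complex.DeMoivre)
    then show ?thesis by (simp only: cis_multiple_2pi Ints_of_int)
  qed
  ultimately show ?thesis
    using geometric_sum[of w n] unfolding w_pow by auto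
qed

text \<open>The squared modulus of the Vandermonde determinant is a double sum over permutations
  \<open>p\<close> and \<open>q\<close>. Summing over independent phases factorises over the points,
  and orthogonality of the characters kills every term with \<open>p\<close> different from
  \<open>q\<close>.\<close>

lemma sum_phases_vandermonde:
  fixes z :: "nat \<Rightarrow> complex" and n :: nat
  defines "\<zeta> \<equiv> \<lambda>m. cis (2 * pi * real m / real n)"
  shows "(\<Sum>f\<in>{..<n} \<rightarrow>\<^sub>E {..<n}. \<Prod>j<n. \<Prod>i<j. (cmod (\<zeta> (f j) * z j - \<zeta> (f i) * z i))\<^sup>2) =
    real n ^ n * (\<Sum>\<sigma> | \<sigma> permutes {0..<n}. \<Prod>i<n. cmod (z i) ^ (2 * \<sigma> i))"
proof -
  let ?S = "{\<sigma>. \<sigma> permutes {0..<n}}" and ?F = "{..<n} \<rightarrow>\<^sub>E {..<n}"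
  \<comment> \<open>The contribution of point \<open>i\<close> with phase \<open>m\<close> to the
    term indexed by \<open>p\<close> and \<open>q\<close>.\<close>
  define T where "T p q i m = (\<zeta> m * z i) ^ p i * cnj ((\<zeta> m * z i) ^ q i)" for p q :: "nat \<Rightarrow> nat" and i m
  have expand: "complex_of_real (\<Prod>j<n. \<Prod>i<j. (cmod (\<zeta> (f j) * z j - \<zeta> (f i) * z i))\<^sup>2) =
      (\<Sum>p\<in>?S. \<Sum>q\<in>?S. signof p * signof q * (\<Prod>i<n. T p q i (f i)))" for f
  proof -
    let ?w = "\<lambda>i. \<zeta> (f i) * z i"
    let ?D = "\<Prod>j<n. \<Prod>i<j. ?w j - ?w i"
    have D: "?D = (\<Sum>p\<in>?S. signof p * (\<Prod>i<n. ?w i ^ p i))"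
      unfolding det_vandermonde[symmetric, of ?w n]
      by (subst det_def'[where n = n]) (auto intro!: sum.cong prod.cong simp: permutes_in_image simp flip: atLeast0LessThan)
    have cD: "cnj ?D = (\<Sum>q\<in>?S. signof q * (\<Prod>i<n. cnj (?w i ^ q i)))"
      unfolding D by (simp add: cnj_sum cnj_prod)
    have "complex_of_real (\<Prod>j<n. \<Prod>i<j. (cmod (?w j - ?w i))\<^sup>2) = ?D * cnj ?D"
      by (simp only: of_real_prod complex_norm_square cnj_prod prod.distrib)
    also have "\<dots> = (\<Sum>p\<in>?S. \<Sum>q\<in>?S. signof p * signof q * (\<Prod>i<n. T p q i (f i)))"
      \<comment> \<open>\<open>cD\<close> comes first, because \<open>D\<close> would also rewrite
        the product under \<open>cnj\<close> and hide it.\<close>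
      unfolding cD unfolding D T_def prod.distrib sum_product by (simp add: mult_ac)
    finally show ?thesis .
  qed
  have inner: "(\<Sum>f\<in>?F. \<Prod>i<n. T p q i (f i)) =
      (if p = q then of_nat n ^ n * (\<Prod>i<n. complex_of_real (cmod (z i) ^ (2 * p i))) else 0)"
    if p: "p \<in> ?S" and q: "q \<in> ?S" for p q
  proof -
    have "(\<Sum>f\<in>?F. \<Prod>i<n. T p q i (f i)) = (\<Prod>i<n. \<Sum>m<n. T p q i m)"
      by (rule prod_sum_PiE[symmetric]) auto
    also have "\<dots> = (\<Prod>i<n. z i ^ p i * cnj (z i ^ q i) * (if p i = q i then of_nat n else 0))"
    proof (rule prod.cong)
      fix i assume "i \<in> {..<n}"
      \<comment> \<open>Permutations of \<open>{0..<n}\<close> keep the exponents below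
        \<open>n\<close>, the range in which the orthogonality relation is available.\<close>
      then have "p i < n" "q i < n"
        using p q permutes_in_image[of p "{0..<n}" i] permutes_in_image[of q "{0..<n}" i] by auto
      then show "(\<Sum>m<n. T p q i m) = z i ^ p i * cnj (z i ^ q i) * (if p i = q i then of_nat n else 0)"
        unfolding sum_roots_of_unity_cnj[symmetric, OF \<open>p i < n\<close> \<open>q i < n\<close>] sum_distrib_left T_def \<zeta>_def
        by (simp add: power_mult_distrib mult_ac)
    qed simp
    also have "\<dots> = (if p = q then of_nat n ^ n * (\<Prod>i<n. complex_of_real (cmod (z i) ^ (2 * p i))) else 0)"
    proof (cases "p = q")
      case True
      have "z i ^ k * cnj (z i ^ k) = complex_of_real (cmod (z i) ^ (2 * k))" for i k
        by (simp add: power_mult flip: power_mult_distrib complex_norm_square)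
      then show ?thesis using True by (simp add: prod.distrib)
    next
      case False
      \<comment> \<open>Both permutations fix everything outside \<open>{0..<n}\<close>, so a place
        where they differ lies inside and contributes a zero factor.\<close>
      then obtain i where "i < n" "p i \<noteq> q i"
        using p q by (metis (no_types, lifting) atLeastLessThan_iff ext mem_Collect_eq permutes_not_in zero_le)
      then show ?thesis using False by auto
    qed
    finally show ?thesis .
  qed
  have sq: "signof p * signof p = (1::complex)" for p :: "nat \<Rightarrow> nat"
    by (simp add: sign_def)
  have "complex_of_real (\<Sum>f\<in>?F. \<Prod>j<n. \<Prod>i<j. (cmod (\<zeta> (f j) * z j - \<zeta> (f i) * z i))\<^sup>2) =
     (\<Sum>f\<in>?F. \<Sum>p\<in>?S. \<Sum>q\<in>?S. signof p * signof q * (\<Prod>i<n. T p q i (f i)))"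
    by (simp only: of_real_sum expand)
  also have "\<dots> = (\<Sum>p\<in>?S. \<Sum>q\<in>?S. signof p * signof q * (\<Sum>f\<in>?F. \<Prod>i<n. T p q i (f i)))"
    by (simp only: sum_distrib_left sum.swap[of _ _ ?F])
  also have "\<dots> = (\<Sum>p\<in>?S. of_nat n ^ n * (\<Prod>i<n. complex_of_real (cmod (z i) ^ (2 * p i))))"
  proof (rule sum.cong[OF refl])
    fix p assume p: "p \<in> ?S"
    have "(\<Sum>q\<in>?S. signof p * signof q * (\<Sum>f\<in>?F. \<Prod>i<n. T p q i (f i))) =
       (\<Sum>q\<in>?S. if p = q then of_nat n ^ n * (\<Prod>i<n. complex_of_real (cmod (z i) ^ (2 * p i))) else 0)"
      by (intro sum.cong refl, subst inner) (use p sq in auto)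
    then show "(\<Sum>q\<in>?S. signof p * signof q * (\<Sum>f\<in>?F. \<Prod>i<n. T p q i (f i))) =
        of_nat n ^ n * (\<Prod>i<n. complex_of_real (cmod (z i) ^ (2 * p i)))"
      using p by (simp add: finite_permutations)
  qed
  also have "\<dots> = complex_of_real (real n ^ n * (\<Sum>\<sigma>\<in>?S. \<Prod>i<n. cmod (z i) ^ (2 * \<sigma> i)))"
    by (simp add: sum_distrib_left)
  finally show ?thesis by (simp only: of_real_eq_iff)
qed

section \<open>Product measures and Lebesgue measure\<close>

text \<open>Sigma-finiteness is assumed for indices in \<open>I\<close>, whereas the locale
  \<open>product_sigma_finite\<close> asks for it everywhere. Putting a Dirac measure outside
  \<open>I\<close> achieves this and leaves the product over \<open>I\<close> unchanged.\<close>

lemma PiM_eqI_sigma_finite: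
  assumes "finite I" and sf: "\<And>i. i \<in> I \<Longrightarrow> sigma_finite_measure (M i)"
    and "sets P = sets (PiM I M)"
    and "\<And>A. (\<And>i. i \<in> I \<Longrightarrow> A i \<in> sets (M i)) \<Longrightarrow>
      emeasure P (Pi\<^sub>E I A) = (\<Prod>i\<in>I. emeasure (M i) (A i))"
  shows "P = PiM I M"
proof -
  define N where "N i = (if i \<in> I then M i else return (count_space UNIV) undefined)" for i
  have PiM_N: "PiM I N = PiM I M"
    by (rule PiM_cong) (simp_all add: N_def)
  have "sigma_finite_measure (N i)" for i
    using sf prob_space.finite_measure[OF prob_space_return, of undefined "count_space UNIV"]
    by (auto simp: N_def finite_measure_def)
  then interpret product_sigma_finite N
    by (simp add: product_sigma_finite_def)
  have "P = PiM I N"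
  proof (rule PiM_eqI)
    show "sets P = sets (PiM I N)" using assms(3) by (simp only: PiM_N)
    show "emeasure P (Pi\<^sub>E I A) = (\<Prod>i\<in>I. emeasure (N i) (A i))"
      if "\<And>i. i \<in> I \<Longrightarrow> A i \<in> sets (N i)" for A
      using that assms(4)[of A] by (simp add: N_def)
  qed fact
  then show ?thesis by (simp only: PiM_N)
qed

text \<open>Boxes pull back to boxes, and boxes determine the product measure. Sigma-finiteness of
  the images is a separate hypothesis because a map can destroy it, for instance by collapsing
  everything to a point.\<close>

lemma distr_PiM_componentwise:
  assumes I: "finite I" and sf: "\<And>i. sigma_finite_measure (M i)"
    and sf': "\<And>i. i \<in> I \<Longrightarrow> sigma_finite_measure (distr (M i) (N i) (f i))"
    and f: "\<And>i. i \<in> I \<Longrightarrow> f i \<in> measurable (M i) (N i)"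
  shows "distr (PiM I M) (PiM I N) (\<lambda>x. \<lambda>i\<in>I. f i (x i)) = PiM I (\<lambda>i. distr (M i) (N i) (f i))"
proof (rule PiM_eqI_sigma_finite[OF I sf'])
  interpret product_sigma_finite M
    using sf by (simp add: product_sigma_finite_def)
  have meas: "(\<lambda>x. \<lambda>i\<in>I. f i (x i)) \<in> measurable (PiM I M) (PiM I N)"
    using f by (intro measurable_restrict) (auto intro: measurable_compose[OF measurable_component_singleton])
  show "sets (distr (PiM I M) (PiM I N) (\<lambda>x. \<lambda>i\<in>I. f i (x i))) = sets (PiM I (\<lambda>i. distr (M i) (N i) (f i)))"
    by (simp cong: sets_PiM_cong)
  fix A assume A: "\<And>i. i \<in> I \<Longrightarrow> A i \<in> sets (distr (M i) (N i) (f i))"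
  have "emeasure (distr (PiM I M) (PiM I N) (\<lambda>x. \<lambda>i\<in>I. f i (x i))) (Pi\<^sub>E I A) =
      emeasure (PiM I M) ((\<lambda>x. \<lambda>i\<in>I. f i (x i)) -` Pi\<^sub>E I A \<inter> space (PiM I M))"
    using A I by (intro emeasure_distr meas sets_PiM_I_finite) auto
  also have "(\<lambda>x. \<lambda>i\<in>I. f i (x i)) -` Pi\<^sub>E I A \<inter> space (PiM I M) = (\<Pi>\<^sub>E i\<in>I. f i -` A i \<inter> space (M i))"
    by (auto simp: space_PiM PiE_iff)
  also have "emeasure (PiM I M) \<dots> = (\<Prod>i\<in>I. emeasure (M i) (f i -` A i \<inter> space (M i)))"
    using A f I by (intro emeasure_PiM) (auto intro: measurable_sets)
  also have "\<dots> = (\<Prod>i\<in>I. emeasure (distr (M i) (N i) (f i)) (A i))"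
    using A f by (intro prod.cong refl) (simp add: emeasure_distr)
  finally show "emeasure (distr (PiM I M) (PiM I N) (\<lambda>x. \<lambda>i\<in>I. f i (x i))) (Pi\<^sub>E I A) =
    (\<Prod>i\<in>I. emeasure (distr (M i) (N i) (f i)) (A i))" .
qed

text \<open>On a box the integrand, including the indicator of the box, is a product of functions of
  one coordinate each, so its integral factorises.\<close>

lemma PiM_density:
  assumes I: "finite I" and sf: "\<And>i. sigma_finite_measure (M i)"
    and sf': "\<And>i. i \<in> I \<Longrightarrow> sigma_finite_measure (density (M i) (f i))"
    and f: "\<And>i. i \<in> I \<Longrightarrow> f i \<in> borel_measurable (M i)"
  shows "PiM I (\<lambda>i. density (M i) (f i)) = density (PiM I M) (\<lambda>x. \<Prod>i\<in>I. f i (x i))"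
proof (rule PiM_eqI_sigma_finite[OF I sf', symmetric])
  interpret product_sigma_finite M
    using sf by (simp add: product_sigma_finite_def)
  have meas: "(\<lambda>x. \<Prod>i\<in>I. f i (x i)) \<in> borel_measurable (PiM I M)"
    using f by (intro borel_measurable_prod_ennreal)
      (auto intro: measurable_compose[OF measurable_component_singleton])
  show "sets (density (PiM I M) (\<lambda>x. \<Prod>i\<in>I. f i (x i))) = sets (PiM I (\<lambda>i. density (M i) (f i)))"
    by (simp cong: sets_PiM_cong)
  fix A assume "\<And>i. i \<in> I \<Longrightarrow> A i \<in> sets (density (M i) (f i))"
  then have A: "\<And>i. i \<in> I \<Longrightarrow> A i \<in> sets (M i)" by simp
  have "emeasure (density (PiM I M) (\<lambda>x. \<Prod>i\<in>I. f i (x i))) (Pi\<^sub>E I A) =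
      (\<integral>\<^sup>+ x. (\<Prod>i\<in>I. f i (x i)) * indicator (Pi\<^sub>E I A) x \<partial>PiM I M)"
    using A I by (intro emeasure_density meas sets_PiM_I_finite) auto
  also have "\<dots> = (\<integral>\<^sup>+ x. (\<Prod>i\<in>I. f i (x i) * indicator (A i) (x i)) \<partial>PiM I M)"
  proof (rule nn_integral_cong)
    fix x assume "x \<in> space (PiM I M)"
    then have "indicator (Pi\<^sub>E I A) x = (\<Prod>i\<in>I. indicator (A i) (x i) :: ennreal)"
      using I by (auto simp: indicator_def space_PiM PiE_iff prod_zero_iff)
    then show "(\<Prod>i\<in>I. f i (x i)) * indicator (Pi\<^sub>E I A) x = (\<Prod>i\<in>I. f i (x i) * indicator (A i) (x i))"
      by (simp add: prod.distrib)
  qed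
  also have "\<dots> = (\<Prod>i\<in>I. \<integral>\<^sup>+ x. f i x * indicator (A i) x \<partial>M i)"
    using A f by (intro product_nn_integral_prod I) auto
  also have "\<dots> = (\<Prod>i\<in>I. emeasure (density (M i) (f i)) (A i))"
    using A f by (intro prod.cong refl) (simp add: emeasure_density)
  finally show "emeasure (density (PiM I M) (\<lambda>x. \<Prod>i\<in>I. f i (x i))) (Pi\<^sub>E I A) =
    (\<Prod>i\<in>I. emeasure (density (M i) (f i)) (A i))" .
qed

section \<open>Uniqueness of Lebesgue measure, linear isometries and the modulus map\<close>

text \<open>Uniqueness of Haar measure, with the unit ball fixing the constant. Sigma-finiteness
  gives Tonelli's theorem, which trades a translation in one variable for a translation in the
  other.\<close>

lemma translation_invariant_eq_lborel:
  fixes M :: "'a::euclidean_space measure"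
  assumes sf: "sigma_finite_measure M" and sets: "sets M = sets borel"
    and trans: "\<And>a. distr M borel (\<lambda>x. a + x) = M"
    and ball: "emeasure M (ball 0 1) = emeasure lborel (ball (0::'a) 1)"
  shows "M = lborel"
proof (rule measure_eqI)
  show "sets M = sets lborel" by (simp add: sets)
  fix A assume "A \<in> sets M"
  then have A[measurable]: "A \<in> sets borel" by (simp add: sets)
  interpret M: sigma_finite_measure M by fact
  interpret pair_sigma_finite M "lborel :: 'a measure" ..
  note sets[measurable_cong]
  define B where "B = ball (0::'a) 1"
  have [measurable]: "B \<in> sets borel" by (simp add: B_def)
  have B_diff: "y - x \<in> B \<longleftrightarrow> - y + x \<in> B" for x y
    by (simp add: B_def norm_minus_commute)
  have M_trans: "(\<integral>\<^sup>+x. h (a + x) \<partial>M) = (\<integral>\<^sup>+x. h x \<partial>M)"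
    if [measurable]: "h \<in> borel_measurable borel" for h a
    by (subst (2) trans[of a, symmetric], subst nn_integral_distr) auto
  have l_trans: "(\<integral>\<^sup>+x. h (a + x) \<partial>lborel) = (\<integral>\<^sup>+x. h x \<partial>lborel)"
    if [measurable]: "h \<in> borel_measurable borel" for h and a :: 'a
    by (subst (2) lborel_distr_plus[of a, symmetric], subst nn_integral_distr) auto
  txt \<open>Both products equal the double integral of \<open>1\<^sub>A (x + y) 1\<^sub>B (y)\<close>; the reflection \<open>B \<mapsto> -B\<close> that
    appears on the way is harmless for a ball.\<close>
  have "emeasure M A * emeasure lborel B = (\<integral>\<^sup>+y. \<integral>\<^sup>+x. indicator A x * indicator B y \<partial>M \<partial>lborel)"
    by (simp add: nn_integral_multc nn_integral_cmult_indicator sets)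
  also have "\<dots> = (\<integral>\<^sup>+y. \<integral>\<^sup>+x. indicator A (y + x) * indicator B y \<partial>M \<partial>lborel)"
    by (intro nn_integral_cong M_trans[symmetric]) measurable
  also have "\<dots> = (\<integral>\<^sup>+x. \<integral>\<^sup>+y. indicator A (y + x) * indicator B y \<partial>lborel \<partial>M)"
    by (rule Fubini') measurable
  also have "\<dots> = (\<integral>\<^sup>+x. \<integral>\<^sup>+y. indicator A y * indicator B (y - x) \<partial>lborel \<partial>M)"
  proof (rule nn_integral_cong)
    fix x
    have "(\<integral>\<^sup>+y. indicator A y * indicator B (y - x) \<partial>lborel) =
        (\<integral>\<^sup>+y. indicator A (x + y) * indicator B (x + y - x) \<partial>lborel)"
      by (rule l_trans[symmetric]) measurable
    then show "(\<integral>\<^sup>+y. indicator A (y + x) * indicator B y \<partial>lborel) =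
        (\<integral>\<^sup>+y. indicator A y * indicator B (y - x) \<partial>lborel)"
      by (simp add: add.commute)
  qed
  also have "\<dots> = (\<integral>\<^sup>+y. \<integral>\<^sup>+x. indicator A y * indicator B (y - x) \<partial>M \<partial>lborel)"
    by (rule Fubini'[symmetric]) measurable
  also have "\<dots> = (\<integral>\<^sup>+y. \<integral>\<^sup>+x. indicator A y * indicator B x \<partial>M \<partial>lborel)"
  proof (rule nn_integral_cong)
    fix y
    have "(\<integral>\<^sup>+x. indicator A y * indicator B (y - x) \<partial>M) =
        (\<integral>\<^sup>+x. indicator A y * indicator B (- y + x) \<partial>M)"
      by (intro nn_integral_cong arg_cong2[where f = "(*)"] refl) (simp only: indicator_def B_diff)
    then show "(\<integral>\<^sup>+x. indicator A y * indicator B (y - x) \<partial>M) = (\<integral>\<^sup>+x. indicator A y * indicator B x \<partial>M)"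
      using M_trans[of "\<lambda>x. indicator A y * indicator B x" "- y"] by simp
  qed
  also have "\<dots> = emeasure lborel A * emeasure M B"
    by (simp add: nn_integral_multc nn_integral_cmult sets)
  finally have "emeasure M A * emeasure lborel B = emeasure lborel A * emeasure lborel B"
    by (simp only: ball B_def)
  moreover have "emeasure lborel B \<noteq> 0" "emeasure lborel B \<noteq> \<infinity>"
    by (simp_all add: emeasure_ball B_def less_imp_neq[OF unit_ball_vol_pos, symmetric])
  ultimately show "emeasure M A = emeasure lborel A"
    by (metis infinity_ennreal_def mult_divide_eq_ennreal)
qed

text \<open>The image measure is translation invariant, since a shift by \<open>f b\<close> after
  \<open>f\<close> is a shift by \<open>b\<close> before it, and the unit ball is its own preimage.
  The result serves for multiplication by unit complex numbers.\<close>

lemma lborel_distr_linear_isometry: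
  fixes f :: "'a::euclidean_space \<Rightarrow> 'a"
  assumes "linear f" and norm: "\<And>x. norm (f x) = norm x"
  shows "distr lborel borel f = lborel"
proof (rule translation_invariant_eq_lborel)
  interpret linear f by fact
  have [measurable]: "f \<in> borel_measurable borel"
    using \<open>linear f\<close> by (intro borel_measurable_continuous_onI linear_continuous_on)
      (simp add: linear_conv_bounded_linear)
  have vim: "f -` ball 0 r = ball 0 r" for r
    using norm by auto
  show "sigma_finite_measure (distr lborel borel f)"
  proof (rule sigma_finite_measure.intro, intro exI conjI)
    let ?A = "range (\<lambda>n::nat. ball (0::'a) (real n))"
    show "countable ?A" "?A \<subseteq> sets (distr lborel borel f)" by auto
    show "\<Union> ?A = space (distr lborel borel f)"
      by (auto simp: reals_Archimedean2)
    show "\<forall>a\<in>?A. emeasure (distr lborel borel f) a \<noteq> \<infinity>"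
      by (auto simp: emeasure_distr vim emeasure_ball)
  qed
  \<comment> \<open>Preserving norms makes the kernel trivial, and finite dimension then gives
    surjectivity, so that every shift has the form \<open>f b\<close>.\<close>
  have "inj f" using norm by (intro linear_injective_0[THEN iffD2] \<open>linear f\<close>) (metis norm_eq_zero)
  then have "surj f" using linear_injective_imp_surjective[OF \<open>linear f\<close>] by blast
  show "distr (distr lborel borel f) borel (\<lambda>x. a + x) = distr lborel borel f" for a
  proof -
    obtain b where b: "a = f b" using \<open>surj f\<close> by blast
    have "distr (distr lborel borel f) borel (\<lambda>x. a + x) = distr (distr lborel borel ((+) b)) borel f"
      by (subst (1 2) distr_distr) (auto simp: b add o_def)
    then show ?thesis by (simp add: lborel_distr_plus)
  qed
  show "emeasure (distr lborel borel f) (ball 0 1) = emeasure lborel (ball (0::'a) 1)"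
    by (simp add: emeasure_distr vim)
qed simp

text \<open>Polar coordinates for radial functions. Half-lines suffice: the preimage of
  \<open>{..a}\<close> is a disc of area \<open>pi * a\<^sup>2\<close>, whose derivative in the
  radius is the density \<open>2 * pi * r\<close>.\<close>

lemma distr_lborel_cmod:
  "distr lborel borel cmod = density lborel (\<lambda>r. ennreal (2 * pi * r) * indicator {0..} r)"
  (is "?L = ?R")
proof (rule measure_eqI_generator_eq[where E = "range atMost" and A = "\<lambda>n. {..real n}" and \<Omega> = UNIV])
  show "Int_stable (range atMost :: real set set)"
    by (auto simp: Int_stable_def)
  show "sets ?L = sigma_sets UNIV (range atMost)" "sets ?R = sigma_sets UNIV (range atMost)"
    by (simp_all add: borel_eq_atMost)
  show "range (\<lambda>n. {..real n}) \<subseteq> range atMost" by auto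
  show "(\<Union>n. {..real n}) = UNIV" by (auto simp: real_arch_simple)
  \<comment> \<open>For negative \<open>a\<close> the disc is empty although
    \<open>pi * a\<^sup>2\<close> is not zero, hence the case distinction.\<close>
  have L: "emeasure ?L {..a} = ennreal (if a < 0 then 0 else pi * a\<^sup>2)" for a
  proof -
    have vim: "cmod -` {..a} = cball 0 a" by auto
    show ?thesis
      by (auto simp: emeasure_distr vim emeasure_cball eval_unit_ball_vol)
  qed
  show "emeasure ?L {..real n} \<noteq> \<infinity>" for n by (simp add: L)
  fix X :: "real set" assume "X \<in> range atMost"
  then obtain a where X: "X = {..a}" by auto
  have "emeasure ?R {..a} = (\<integral>\<^sup>+r. ennreal (2 * pi * r) * indicator {0..} r * indicator {..a} r \<partial>lborel)"
    by (subst emeasure_density) auto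
  also have "\<dots> = (\<integral>\<^sup>+r. ennreal (2 * pi * r) * indicator {0..a} r \<partial>lborel)"
    by (intro nn_integral_cong) (auto simp: indicator_def)
  also have "\<dots> = ennreal (if a < 0 then 0 else pi * a\<^sup>2)"
  proof (cases "a < 0")
    case False
    have "(\<integral>\<^sup>+r. ennreal (2 * pi * r) * indicator {0..a} r \<partial>lborel) = ennreal (pi * a\<^sup>2 - pi * 0\<^sup>2)"
      using False by (intro nn_integral_FTC_Icc) (auto intro!: derivative_eq_intros)
    then show ?thesis using False by simp
  qed simp
  finally show "emeasure ?L X = emeasure ?R X" by (simp add: X L)
qed simp

section \<open>Symmetric functionals of the points\<close>

text \<open>\<open>sort\<close> depends on the multiset of values, which a permutation of the
  indices preserves.\<close>

lemma decreasing_reordering_perm: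
  assumes "bij_betw \<tau> {1..n} {1..n}"
  shows "decreasing_reordering n (\<lambda>j. x (\<tau> j)) = decreasing_reordering n x"
proof -
  have "mset (map (\<lambda>j. x (\<tau> j)) [1..<Suc n]) = image_mset x (image_mset \<tau> (mset_set {1..n}))"
    by (simp add: multiset.map_comp o_def mset_upt atLeastLessThanSuc_atLeastAtMost del: upt_Suc)
  also have "image_mset \<tau> (mset_set {1..n}) = mset_set {1..n}"
    using assms by (simp add: image_mset_mset_set bij_betw_def)
  also have "image_mset x \<dots> = mset (map x [1..<Suc n])"
    by (simp add: mset_upt atLeastLessThanSuc_atLeastAtMost del: upt_Suc)
  finally have "sort (map (\<lambda>j. x (\<tau> j)) [1..<Suc n]) = sort (map x [1..<Suc n])"
    by (metis sorted_list_of_multiset_mset)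
  then show ?thesis by (simp only: decreasing_reordering_def)
qed

lemma decreasing_reordering_cong:
  assumes "\<And>j. j \<in> {1..n} \<Longrightarrow> x j = y j"
  shows "decreasing_reordering n x = decreasing_reordering n y"
proof -
  have "map x [1..<Suc n] = map y [1..<Suc n]"
    using assms by (intro map_cong) auto
  then show ?thesis by (simp only: decreasing_reordering_def)
qed

lemma dirac_sum_perm:
  assumes "bij_betw \<tau> {1..n} {1..n}"
  shows "dirac_sum n (\<lambda>j. x (\<tau> j)) = dirac_sum n x"
  unfolding dirac_sum_def
  by (subst sum.reindex_bij_betw[OF assms, of "\<lambda>k. emeasure (return borel (x k)) _"]) simp

lemma dirac_sum_cong:
  assumes "\<And>j. j \<in> {1..n} \<Longrightarrow> x j = y j"
  shows "dirac_sum n x = dirac_sum n y"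
proof -
  have "(\<lambda>A. \<Sum>k=1..n. emeasure (return borel (x k)) A) = (\<lambda>A. \<Sum>k=1..n. emeasure (return borel (y k)) A)"
    by (intro ext sum.cong refl) (simp only: assms)
  then show ?thesis by (simp only: dirac_sum_def)
qed

section \<open>Measurability of the order statistics and of the point process\<close>

text \<open>In a sorted list the entries at most \<open>a\<close> form an initial segment, so
  \<open>filter\<close> and \<open>takeWhile\<close> agree there. This turns a condition on an order
  statistic into a count.\<close>

lemma nth_sort_le_iff:
  fixes xs :: "'a::linorder list"
  assumes "i < length xs"
  shows "sort xs ! i \<le> a \<longleftrightarrow> i < length (filter (\<lambda>x. x \<le> a) xs)"
proof -
  have "length (filter (\<lambda>x. x \<le> a) xs) = length (filter (\<lambda>x. x \<le> a) (sort xs))"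
    by (metis filter_sort length_sort)
  also have "filter (\<lambda>x. x \<le> a) (sort xs) = takeWhile (\<lambda>x. x \<le> a) (sort xs)"
  proof -
    have "filter (\<lambda>x. x \<le> a) ys = takeWhile (\<lambda>x. x \<le> a) ys" if "sorted ys" for ys
      using that
    proof (induction ys)
      case (Cons b ys)
      then show ?case by (cases ys) auto
    qed simp
    then show ?thesis by simp
  qed
  finally have len: "length (filter (\<lambda>x. x \<le> a) xs) = length (takeWhile (\<lambda>x. x \<le> a) (sort xs))" .
  show ?thesis
  proof
    assume "sort xs ! i \<le> a"
    then have "sort xs ! j \<le> a" if "j < Suc i" for j
      using that assms sorted_nth_mono[OF sorted_sort, of j i xs] by force
    then have "Suc i \<le> length (takeWhile (\<lambda>x. x \<le> a) (sort xs))"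
      using assms by (intro length_takeWhile_less_P_nth) auto
    then show "i < length (filter (\<lambda>x. x \<le> a) xs)" by (simp add: len)
  next
    assume "i < length (filter (\<lambda>x. x \<le> a) xs)"
    then have *: "i < length (takeWhile (\<lambda>x. x \<le> a) (sort xs))" by (simp add: len)
    then show "sort xs ! i \<le> a"
      using nth_mem[OF *] takeWhile_nth[OF *] by (metis set_takeWhileD)
  qed
qed

text \<open>A sublevel set of coordinate \<open>k\<close> says that more than \<open>n - k\<close>
  of the values are at most \<open>a\<close>, a condition on a finite sum of indicators.\<close>

lemma measurable_decreasing_reordering:
  "decreasing_reordering n \<in> measurable (\<Pi>\<^sub>M k\<in>{1..n}. borel) (\<Pi>\<^sub>M k\<in>{1..n}. borel)"
  unfolding decreasing_reordering_def
proof (rule measurable_restrict)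
  fix k assume k: "k \<in> {1..n}"
  show "(\<lambda>x :: nat \<Rightarrow> real. rev (sort (map x [1..<Suc n])) ! (k - 1)) \<in> measurable (\<Pi>\<^sub>M k\<in>{1..n}. borel) borel"
  proof (subst borel_measurable_iff_le, rule allI)
    fix a :: real
    have "rev (sort (map x [1..<Suc n])) ! (k - 1) \<le> a \<longleftrightarrow>
        real (n - k) < (\<Sum>j\<in>{1..n}. indicator {..a} (x j))" for x
    proof -
      have len: "length (filter (\<lambda>x. x \<le> a) (map x [1..<Suc n])) = (\<Sum>j\<in>{1..n}. indicator {..a} (x j))"
      proof -
        have "length (filter (\<lambda>x. x \<le> a) (map x [1..<Suc n])) = card {j \<in> {1..n}. x j \<le> a}"
          by (auto simp: filter_map o_def distinct_length_filter simp del: upt_Suc intro!: arg_cong[where f = card])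
        also have "\<dots> = (\<Sum>j\<in>{1..n}. indicator {..a} (x j))"
          by (subst card_eq_sum) (simp add: sum.If_cases indicator_def Int_def)
        finally show ?thesis .
      qed
      \<comment> \<open>Positions count from 0: the \<open>k\<close>-th largest of \<open>n\<close>
        values sits at place \<open>n - k\<close> in increasing order.\<close>
      have "rev (sort (map x [1..<Suc n])) ! (k - 1) = sort (map x [1..<Suc n]) ! (n - k)"
        using k by (subst rev_nth) (auto simp del: upt_Suc)
      also have "\<dots> \<le> a \<longleftrightarrow> n - k < length (filter (\<lambda>x. x \<le> a) (map x [1..<Suc n]))"
        using k by (intro nth_sort_le_iff) auto
      also have "\<dots> \<longleftrightarrow> real (n - k) < real (\<Sum>j\<in>{1..n}. indicator {..a} (x j))"
        by (simp only: len of_nat_less_iff)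
      also have "real (\<Sum>j\<in>{1..n}. indicator {..a} (x j)) = (\<Sum>j\<in>{1..n}. indicator {..a} (x j))"
        by (simp add: indicator_def)
      finally show ?thesis .
    qed
    then have "{x \<in> space (\<Pi>\<^sub>M k\<in>{1..n}. borel). rev (sort (map x [1..<Suc n])) ! (k - 1) \<le> a} =
       {x \<in> space (\<Pi>\<^sub>M k\<in>{1..n}. borel). real (n - k) < (\<Sum>j\<in>{1..n}. indicator {..a} (x j))}"
      by simp
    also have "\<dots> \<in> sets (\<Pi>\<^sub>M k\<in>{1..n}. borel)"
      by measurable
    finally show "{x \<in> space (\<Pi>\<^sub>M k\<in>{1..n}. borel). rev (sort (map x [1..<Suc n])) ! (k - 1) \<le> a}
      \<in> sets (\<Pi>\<^sub>M k\<in>{1..n}. borel)" .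
  qed
qed

text \<open>It suffices to treat the generators of \<open>measure_algebra\<close>. Evaluating the
  point process on \<open>A\<close> counts the coordinates in \<open>A\<close>, a finite sum of
  measurable indicators.\<close>

lemma measurable_dirac_sum:
  "dirac_sum n \<in> measurable (\<Pi>\<^sub>M k\<in>{1..n}. borel) (measure_algebra borel)"
  unfolding measure_algebra_def
proof (rule measurable_measure_of)
  have sets_ds: "sets (dirac_sum n x) = sets borel" for x
    unfolding dirac_sum_def using sets.sigma_sets_eq[of "borel :: real measure"]
    by (simp add: sets.space_closed[of "borel :: real measure", simplified])
  then show "dirac_sum n \<in> space (\<Pi>\<^sub>M k\<in>{1..n}. borel) \<rightarrow> {\<mu>. sets \<mu> = sets borel}"
    by simp
  fix y :: "real measure set"
  assume "y \<in> {{\<mu>. sets \<mu> = sets borel \<and> emeasure \<mu> A \<in> B} |A B. A \<in> sets borel \<and> B \<in> sets borel}"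
  then obtain A B where y: "y = {\<mu>. sets \<mu> = sets borel \<and> emeasure \<mu> A \<in> B}"
    and [measurable]: "A \<in> sets borel" "B \<in> sets borel"
    by auto
  have "dirac_sum n -` y \<inter> space (\<Pi>\<^sub>M k\<in>{1..n}. borel) =
     {x \<in> space (\<Pi>\<^sub>M k\<in>{1..n}. borel). (\<Sum>k\<in>{1..n}. indicator A (x k)) \<in> B}"
    by (auto simp: y sets_ds emeasure_dirac_sum)
  also have "\<dots> \<in> sets (\<Pi>\<^sub>M k\<in>{1..n}. borel)"
    by measurable
  finally show "dirac_sum n -` y \<inter> space (\<Pi>\<^sub>M k\<in>{1..n}. borel) \<in> sets (\<Pi>\<^sub>M k\<in>{1..n}. borel)" .
qed auto

section \<open>The gas and its moduli\<close>

text \<open>Indices are shifted to start at 0 and each pair is listed under its larger index, so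
  that the product takes the shape of \<open>det_vandermonde\<close>.\<close>

lemma gas_weight_eq:
  "gas_weight V n z = (\<Prod>j=1..n. exp (- real n * V (cmod (z j)))) *
     (\<Prod>k<n. \<Prod>j<k. (cmod (z (Suc k) - z (Suc j)))\<^sup>2)"
proof -
  have "(\<Prod>(j, k)\<in>{(j, k). 1 \<le> j \<and> j < k \<and> k \<le> n}. (cmod (z j - z k))\<^sup>2) =
      (\<Prod>(k, j)\<in>(SIGMA k:{..<n}. {..<k}). (cmod (z (Suc k) - z (Suc j)))\<^sup>2)"
    by (rule prod.reindex_bij_witness[where i = "\<lambda>(k, j). (Suc j, Suc k)" and j = "\<lambda>(j, k). (k - 1, j - 1)"])
      (auto simp: norm_minus_commute)
  then show ?thesis
    by (simp add: gas_weight_def prod.Sigma)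
qed

lemma gas_weight_nonneg: "gas_weight V n z \<ge> 0"
  by (auto simp: gas_weight_def intro!: mult_nonneg_nonneg prod_nonneg)

lemma measurable_gas_weight [measurable]:
  assumes [measurable]: "(\<lambda>z. V (cmod z)) \<in> borel_measurable borel"
  shows "gas_weight V n \<in> borel_measurable (\<Pi>\<^sub>M j\<in>{1..n}. lborel)"
  unfolding gas_weight_eq[abs_def] by measurable

text \<open>Rotations leave the potential factor alone, so it comes out of the sum and the
  Vandermonde average applies. Phases are indexed from 0 and points from 1, hence
  \<open>j - 1\<close>.\<close>

lemma sum_phases_gas_weight:
  fixes z :: "nat \<Rightarrow> complex" and n :: nat
  defines "u \<equiv> \<lambda>f j. cis (2 * pi * real (f (j - 1)) / real n)"
  shows "(\<Sum>f\<in>{..<n} \<rightarrow>\<^sub>E {..<n}. gas_weight V n (\<lambda>j\<in>{1..n}. u f j * z j)) =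
    real n ^ n * (\<Sum>\<sigma> | \<sigma> permutes {0..<n}.
      \<Prod>j=1..n. cmod (z j) ^ (2 * \<sigma> (j - 1)) * exp (- real n * V (cmod (z j))))"
proof -
  define E where "E = (\<Prod>j=1..n. exp (- real n * V (cmod (z j))))"
  have "gas_weight V n (\<lambda>j\<in>{1..n}. u f j * z j) = E * (\<Prod>k<n. \<Prod>j<k.
      (cmod (cis (2 * pi * real (f k) / real n) * z (Suc k) - cis (2 * pi * real (f j) / real n) * z (Suc j)))\<^sup>2)" for f
    unfolding gas_weight_eq E_def
    by (intro arg_cong2[where f = "(*)"] prod.cong refl) (auto simp: u_def norm_mult)
  then have "(\<Sum>f\<in>{..<n} \<rightarrow>\<^sub>E {..<n}. gas_weight V n (\<lambda>j\<in>{1..n}. u f j * z j)) =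
      E * (real n ^ n * (\<Sum>\<sigma> | \<sigma> permutes {0..<n}. \<Prod>i<n. cmod (z (Suc i)) ^ (2 * \<sigma> i)))"
    by (simp only: sum_phases_vandermonde[of n "\<lambda>i. z (Suc i)"] flip: sum_distrib_left)
  also have "\<dots> = real n ^ n * ((\<Sum>\<sigma> | \<sigma> permutes {0..<n}. \<Prod>i<n. cmod (z (Suc i)) ^ (2 * \<sigma> i)) * E)"
    by (simp only: mult_ac)
  also have "(\<lambda>\<sigma> :: nat \<Rightarrow> nat. \<Prod>i<n. cmod (z (Suc i)) ^ (2 * \<sigma> i)) = (\<lambda>\<sigma>. \<Prod>j=1..n. cmod (z j) ^ (2 * \<sigma> (j - 1)))"
    by (rule ext, rule prod.reindex_bij_witness[where i = "\<lambda>j. j - 1" and j = Suc]) auto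
  finally show ?thesis by (simp only: E_def prod.distrib sum_distrib_right)
qed

text \<open>Rotating each point changes neither Lebesgue measure nor the value of \<open>H\<close>
  at the moduli. The integral therefore equals its average over all \<open>n ^ n\<close> choices of
  phases, in which the weight alone gets averaged.\<close>

lemma nn_integral_gas_weight:
  assumes [measurable]: "(\<lambda>z. V (cmod z)) \<in> borel_measurable borel"
    and H[measurable]: "H \<in> borel_measurable (\<Pi>\<^sub>M j\<in>{1..n}. borel)"
    and n: "n \<ge> 1"
  shows "(\<integral>\<^sup>+z. H (\<lambda>j\<in>{1..n}. cmod (z j)) * ennreal (gas_weight V n z) \<partial>(\<Pi>\<^sub>M j\<in>{1..n}. lborel)) =
    (\<integral>\<^sup>+z. H (\<lambda>j\<in>{1..n}. cmod (z j)) * ennreal (\<Sum>\<sigma> | \<sigma> permutes {0..<n}.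
      \<Prod>j=1..n. cmod (z j) ^ (2 * \<sigma> (j - 1)) * exp (- real n * V (cmod (z j)))) \<partial>(\<Pi>\<^sub>M j\<in>{1..n}. lborel))"
proof -
  let ?I = "{1..n}" and ?F = "{..<n} \<rightarrow>\<^sub>E {..<n}"
  let ?L = "\<Pi>\<^sub>M j\<in>?I. lborel :: complex measure"
  let ?h = "\<lambda>z :: nat \<Rightarrow> complex. H (\<lambda>j\<in>?I. cmod (z j))"
  let ?W = "\<lambda>z. ennreal (gas_weight V n z)"
  define u where "u f j = cis (2 * pi * real (f (j - 1)) / real n)" for f :: "nat \<Rightarrow> nat" and j
  define S where "S z = (\<Sum>\<sigma> | \<sigma> permutes {0..<n}.
      \<Prod>j=1..n. cmod (z j) ^ (2 * \<sigma> (j - 1)) * exp (- real n * V (cmod (z j))))" for z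
  have rot: "(\<integral>\<^sup>+z. ?h z * ?W z \<partial>?L) = (\<integral>\<^sup>+z. ?h z * ?W (\<lambda>j\<in>?I. u f j * z j) \<partial>?L)" for f
  proof -
    have rot1: "distr lborel borel ((*) (u f j)) = lborel" for j
      by (rule lborel_distr_linear_isometry) (auto simp: u_def norm_mult intro: linear_times)
    have "distr ?L (\<Pi>\<^sub>M j\<in>?I. borel) (\<lambda>z. \<lambda>j\<in>?I. u f j * z j) = (\<Pi>\<^sub>M j\<in>?I. distr lborel borel ((*) (u f j)))"
      by (rule distr_PiM_componentwise) (auto simp: rot1 intro: sigma_finite_lborel)
    then have L: "distr ?L (\<Pi>\<^sub>M j\<in>?I. borel) (\<lambda>z. \<lambda>j\<in>?I. u f j * z j) = ?L"
      by (simp only: rot1)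
    have h_rot: "?h (\<lambda>j\<in>?I. u f j * z j) = ?h z" for z
      by (simp add: u_def norm_mult cong: restrict_cong)
    have "(\<integral>\<^sup>+z. ?h z * ?W z \<partial>?L) = (\<integral>\<^sup>+z. ?h (\<lambda>j\<in>?I. u f j * z j) * ?W (\<lambda>j\<in>?I. u f j * z j) \<partial>?L)"
      by (subst (1) L[symmetric], subst nn_integral_distr) measurable
    then show ?thesis by (simp only: h_rot)
  qed
  have card: "card ?F = n ^ n"
    by (simp add: card_PiE)
  have "of_nat (n ^ n) * (\<integral>\<^sup>+z. ?h z * ?W z \<partial>?L) = (\<Sum>f\<in>?F. \<integral>\<^sup>+z. ?h z * ?W (\<lambda>j\<in>?I. u f j * z j) \<partial>?L)"
    by (simp only: card sum_constant flip: rot)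
  also have "\<dots> = (\<integral>\<^sup>+z. (\<Sum>f\<in>?F. ?h z * ?W (\<lambda>j\<in>?I. u f j * z j)) \<partial>?L)"
    by (rule nn_integral_sum[symmetric]) measurable
  also have "\<dots> = (\<integral>\<^sup>+z. of_nat (n ^ n) * (?h z * ennreal (S z)) \<partial>?L)"
  proof (rule nn_integral_cong)
    fix z :: "nat \<Rightarrow> complex"
    have "(\<Sum>f\<in>?F. ?h z * ?W (\<lambda>j\<in>?I. u f j * z j)) = ?h z * ennreal (\<Sum>f\<in>?F. gas_weight V n (\<lambda>j\<in>?I. u f j * z j))"
      by (simp only: sum_ennreal gas_weight_nonneg flip: sum_distrib_left)
    also have "(\<Sum>f\<in>?F. gas_weight V n (\<lambda>j\<in>?I. u f j * z j)) = real (n ^ n) * S z"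
      unfolding u_def S_def by (subst sum_phases_gas_weight) simp
    also have "?h z * ennreal (real (n ^ n) * S z) = of_nat (n ^ n) * (?h z * ennreal (S z))"
    proof -
      have "ennreal (real (n ^ n) * S z) = of_nat (n ^ n) * ennreal (S z)"
        by (subst ennreal_mult') (simp_all only: ennreal_of_nat_eq_real_of_nat of_nat_0_le_iff)
      then show ?thesis by (simp only: mult_ac)
    qed
    finally show "(\<Sum>f\<in>?F. ?h z * ?W (\<lambda>j\<in>?I. u f j * z j)) = of_nat (n ^ n) * (?h z * ennreal (S z))" .
  qed
  also have "\<dots> = of_nat (n ^ n) * (\<integral>\<^sup>+z. ?h z * ennreal (S z) \<partial>?L)"
    unfolding S_def by (rule nn_integral_cmult) measurable
  \<comment> \<open>Cancelling in \<open>ennreal\<close> requires \<open>n ^ n\<close> to be nonzero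
    and finite.\<close>
  finally show ?thesis
    using n unfolding S_def by (subst (asm) ennreal_mult_cancel_left) (auto simp del: of_nat_power)
qed

section \<open>Radial laws as laws of moduli, and their products\<close>

text \<open>The polar Jacobian \<open>2 * pi * t\<close> absorbs one power of \<open>t\<close> and
  leaves the even power \<open>2 * (k - 1)\<close>. The radial variable becomes the modulus of a
  planar point, so both sides of the comparison can be written over complex vectors.\<close>

lemma distr_radial_law:
  assumes cont: "continuous_on UNIV (\<lambda>z::complex. V (cmod z))"
    and k: "k \<ge> 1" and c: "c > 0"
    and X: "distributed P' lborel X (\<lambda>t. ennreal (c * radial_weight V n k t))"
  shows "distr P' borel X = distr (density lborel (\<lambda>z. ennreal
    (c / (2 * pi) * (cmod z ^ (2 * (k - 1)) * exp (- real n * V (cmod z)))))) borel cmod"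
proof -
  have "continuous_on UNIV (\<lambda>r. V (cmod (complex_of_real r)))"
    using continuous_on_compose2[OF cont, of UNIV complex_of_real] by (simp add: continuous_on_of_real)
  then have [measurable]: "(\<lambda>r. V \<bar>r\<bar>) \<in> borel_measurable borel"
    by (intro borel_measurable_continuous_onI) simp
  txt \<open>The absolute value is there because nothing is known about \<open>V\<close> on the negative reals,
    not even measurability.\<close>
  define g where "g r = ennreal (c / (2 * pi) * (\<bar>r\<bar> ^ (2 * (k - 1)) * exp (- real n * V \<bar>r\<bar>)))" for r :: real
  have [measurable]: "g \<in> borel_measurable borel" unfolding g_def[abs_def] by measurable
  have weight: "ennreal (c * radial_weight V n k r) = ennreal (2 * pi * r) * indicator {0..} r * g r" for r
  proof (cases "r \<ge> 0")
    case True
    \<comment> \<open>Natural subtraction truncates, so this uses that \<open>k\<close> is at least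
      1. The extra factor belongs to the Jacobian.\<close>
    have "2 * k - 1 = Suc (2 * (k - 1))" using k by simp
    then have "c * radial_weight V n k r =
        (2 * pi * r) * (c / (2 * pi) * (r ^ (2 * (k - 1)) * exp (- real n * V r)))"
      using True by (simp add: radial_weight_def)
    then show ?thesis
      using True c by (simp add: g_def flip: ennreal_mult')
  qed (simp add: radial_weight_def)
  have "distr P' borel X = distr P' lborel X"
    by (rule distr_cong) simp_all
  also have "\<dots> = density lborel (\<lambda>r. ennreal (2 * pi * r) * indicator {0..} r * g r)"
    using distributed_distr_eq_density[OF X] by (simp only: weight)
  \<comment> \<open>The factors other than \<open>g\<close> form the density of the modulus under
    planar Lebesgue measure.\<close>
  also have "\<dots> = density (distr lborel borel cmod) g"
    by (subst distr_lborel_cmod, subst density_density_eq) simp_all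
  also have "\<dots> = distr (density lborel (\<lambda>z. g (cmod z))) borel cmod"
    by (rule density_distr) simp_all
  finally show ?thesis by (simp add: g_def)
qed

text \<open>Symmetry of \<open>H\<close> allows the independent coordinates to be permuted before
  each law is written as a modulus law. The permutation then shows in the exponents alone, so the
  same left side matches every \<sigma>.\<close>

lemma nn_integral_PiM_radial_perm:
  assumes V[measurable]: "(\<lambda>z. V (cmod z)) \<in> borel_measurable borel"
    and d: "\<And>k. k \<in> {1..n} \<Longrightarrow> d k > (0::real)"
    and law: "\<And>k. k \<in> {1..n} \<Longrightarrow> \<mu> k = distr (density lborel (\<lambda>z. ennreal
      (d k * (cmod z ^ (2 * (k - 1)) * exp (- real n * V (cmod z)))))) borel cmod"
    and prob: "\<And>k. k \<in> {1..n} \<Longrightarrow> prob_space (\<mu> k)"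
    and H[measurable]: "H \<in> borel_measurable (\<Pi>\<^sub>M j\<in>{1..n}. borel)"
    and sym: "\<And>\<tau> x. bij_betw \<tau> {1..n} {1..n} \<Longrightarrow> H (\<lambda>j\<in>{1..n}. x (\<tau> j)) = H (\<lambda>j\<in>{1..n}. x j)"
    and \<sigma>: "\<sigma> permutes {0..<n}"
  shows "(\<integral>\<^sup>+x. H x \<partial>PiM {1..n} \<mu>) = ennreal (\<Prod>k=1..n. d k) *
    (\<integral>\<^sup>+z. H (\<lambda>j\<in>{1..n}. cmod (z j)) * ennreal (\<Prod>j=1..n. cmod (z j) ^ (2 * \<sigma> (j - 1)) *
      exp (- real n * V (cmod (z j)))) \<partial>(\<Pi>\<^sub>M j\<in>{1..n}. lborel))"
proof -
  let ?I = "{1..n}"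
  let ?L = "\<Pi>\<^sub>M j\<in>?I. lborel :: complex measure"
  \<comment> \<open>The permutation \<sigma> of \<open>{0..<n}\<close> carried over to
    \<open>1..n\<close>, so that the exponent \<open>2 * (\<tau> j - 1)\<close> is
    \<open>2 * \<sigma> (j - 1)\<close>.\<close>
  define \<tau> where "\<tau> j = Suc (\<sigma> (j - 1))" for j
  have bij: "bij_betw \<tau> ?I ?I"
  proof -
    have "bij_betw (\<lambda>j. j - 1) ?I {0..<n}"
      by (rule bij_betw_byWitness[where f' = Suc]) auto
    moreover have "bij_betw \<sigma> {0..<n} {0..<n}"
      using \<sigma> by (rule permutes_imp_bij)
    moreover have "bij_betw Suc {0..<n} ?I"
      by (rule bij_betw_byWitness[where f' = "\<lambda>j. j - 1"]) auto
    ultimately have "bij_betw (Suc \<circ> (\<sigma> \<circ> (\<lambda>j. j - 1))) ?I ?I"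
      by (blast intro: bij_betw_trans)
    then show ?thesis by (simp add: \<tau>_def[abs_def] o_def)
  qed
  have \<tau>: "\<tau> j \<in> ?I" if "j \<in> ?I" for j
    using bij that by (auto simp: bij_betw_def)
  define g where "g k z = d k * (cmod z ^ (2 * (k - 1)) * exp (- real n * V (cmod z)))" for k z
  have g[measurable]: "g k \<in> borel_measurable borel" for k
    unfolding g_def[abs_def] by measurable
  have g_nonneg: "g k z \<ge> 0" if "k \<in> ?I" for k z
    using d[OF that] by (simp add: g_def)
  let ?\<nu> = "\<lambda>k. density lborel (\<lambda>z. ennreal (g k z))"
  \<comment> \<open>Stated for every \<open>k\<close>, since \<open>distr_PiM_componentwise\<close>
    wants sigma-finite factors at all indices. A finite-valued density suffices.\<close>
  have sf_\<nu>: "sigma_finite_measure (?\<nu> k)" for k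
    by (subst sigma_finite_measure.sigma_finite_iff_density_finite[OF sigma_finite_lborel]) auto
  have law': "\<mu> (\<tau> j) = distr (?\<nu> (\<tau> j)) borel cmod" if "j \<in> ?I" for j
    using law[OF \<tau>[OF that]] by (simp add: g_def)
  have sets_\<mu>: "sets (\<mu> k) = sets borel" if "k \<in> ?I" for k
    using law[OF that] by simp
  have sets_PiM_\<mu>[measurable_cong]: "sets (PiM ?I \<mu>) = sets (\<Pi>\<^sub>M j\<in>?I. borel)"
    "sets (\<Pi>\<^sub>M j\<in>?I. \<mu> (\<tau> j)) = sets (\<Pi>\<^sub>M j\<in>?I. borel)"
    using sets_\<mu> \<tau> by (auto intro!: sets_PiM_cong)
  have reindex: "distr (PiM ?I \<mu>) (\<Pi>\<^sub>M j\<in>?I. \<mu> (\<tau> j)) (\<lambda>\<omega>. \<lambda>j\<in>?I. \<omega> (\<tau> j)) = (\<Pi>\<^sub>M j\<in>?I. \<mu> (\<tau> j))"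
    using bij by (intro distr_PiM_reindex prob) (auto simp: bij_betw_def)
  have "(\<integral>\<^sup>+x. H x \<partial>PiM ?I \<mu>) = (\<integral>\<^sup>+x. H (\<lambda>j\<in>?I. x (\<tau> j)) \<partial>PiM ?I \<mu>)"
  proof (rule nn_integral_cong)
    fix x assume "x \<in> space (PiM ?I \<mu>)"
    then have "(\<lambda>j\<in>?I. x j) = x" by (auto simp: space_PiM PiE_restrict)
    then show "H x = H (\<lambda>j\<in>?I. x (\<tau> j))" by (simp only: sym[OF bij, of x])
  qed
  also have "\<dots> = (\<integral>\<^sup>+x. H x \<partial>distr (PiM ?I \<mu>) (\<Pi>\<^sub>M j\<in>?I. \<mu> (\<tau> j)) (\<lambda>\<omega>. \<lambda>j\<in>?I. \<omega> (\<tau> j)))"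
  proof (rule nn_integral_distr[symmetric])
    have "(\<lambda>\<omega>. \<lambda>j\<in>?I. \<omega> (\<tau> j)) \<in> measurable (\<Pi>\<^sub>M j\<in>?I. borel :: real measure) (\<Pi>\<^sub>M j\<in>?I. borel)"
    proof (rule measurable_restrict)
      fix j assume "j \<in> ?I"
      then show "(\<lambda>\<omega>. \<omega> (\<tau> j)) \<in> measurable (\<Pi>\<^sub>M j\<in>?I. borel :: real measure) borel"
        using measurable_component_singleton[OF \<tau>, of j "\<lambda>_. borel"] by simp
    qed
    then show "(\<lambda>\<omega>. \<lambda>j\<in>?I. \<omega> (\<tau> j)) \<in> measurable (PiM ?I \<mu>) (\<Pi>\<^sub>M j\<in>?I. \<mu> (\<tau> j))"
      by (simp only: measurable_cong_sets[OF sets_PiM_\<mu>])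
  qed measurable
  also note reindex
  also have "(\<Pi>\<^sub>M j\<in>?I. \<mu> (\<tau> j)) = (\<Pi>\<^sub>M j\<in>?I. distr (?\<nu> (\<tau> j)) borel cmod)"
    by (rule PiM_cong) (simp_all only: law')
  also have "\<dots> = distr (\<Pi>\<^sub>M j\<in>?I. ?\<nu> (\<tau> j)) (\<Pi>\<^sub>M j\<in>?I. borel) (\<lambda>z. \<lambda>j\<in>?I. cmod (z j))"
    using prob[OF \<tau>] by (intro distr_PiM_componentwise[symmetric] sf_\<nu>)
      (auto simp flip: law' intro: prob_space_imp_sigma_finite)
  also have "(\<Pi>\<^sub>M j\<in>?I. ?\<nu> (\<tau> j)) = density ?L (\<lambda>z. \<Prod>j\<in>?I. ennreal (g (\<tau> j) (z j)))"
    by (intro PiM_density sf_\<nu>) (auto intro: sigma_finite_lborel)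
  also have "(\<integral>\<^sup>+x. H x \<partial>distr \<dots> (\<Pi>\<^sub>M j\<in>?I. borel) (\<lambda>z. \<lambda>j\<in>?I. cmod (z j))) =
      (\<integral>\<^sup>+z. (\<Prod>j\<in>?I. ennreal (g (\<tau> j) (z j))) * H (\<lambda>j\<in>?I. cmod (z j)) \<partial>?L)"
    by (subst nn_integral_distr, measurable, subst nn_integral_density) measurable
  also have "\<dots> = (\<integral>\<^sup>+z. ennreal (\<Prod>k\<in>?I. d k) * (H (\<lambda>j\<in>?I. cmod (z j)) *
      ennreal (\<Prod>j\<in>?I. cmod (z j) ^ (2 * \<sigma> (j - 1)) * exp (- real n * V (cmod (z j))))) \<partial>?L)"
  proof (rule nn_integral_cong)
    fix z :: "nat \<Rightarrow> complex"
    have "(\<Prod>j\<in>?I. ennreal (g (\<tau> j) (z j))) = ennreal (\<Prod>j\<in>?I. g (\<tau> j) (z j))"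
      using g_nonneg \<tau> by (intro prod_ennreal) auto
    also have "(\<Prod>j\<in>?I. g (\<tau> j) (z j)) = (\<Prod>j\<in>?I. d (\<tau> j)) *
        (\<Prod>j\<in>?I. cmod (z j) ^ (2 * \<sigma> (j - 1)) * exp (- real n * V (cmod (z j))))"
      by (simp add: g_def \<tau>_def prod.distrib)
    \<comment> \<open>The constants are multiplied over all of \<open>1..n\<close>, so reindexing
      removes the permutation from them.\<close>
    also have "(\<Prod>j\<in>?I. d (\<tau> j)) = (\<Prod>k\<in>?I. d k)"
      by (rule prod.reindex_bij_betw[OF bij])
    also have "ennreal ((\<Prod>k\<in>?I. d k) * (\<Prod>j\<in>?I. cmod (z j) ^ (2 * \<sigma> (j - 1)) * exp (- real n * V (cmod (z j))))) =
        ennreal (\<Prod>k\<in>?I. d k) * ennreal (\<Prod>j\<in>?I. cmod (z j) ^ (2 * \<sigma> (j - 1)) * exp (- real n * V (cmod (z j))))"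
      by (intro ennreal_mult' prod_nonneg less_imp_le d)
    finally show "(\<Prod>j\<in>?I. ennreal (g (\<tau> j) (z j))) * H (\<lambda>j\<in>?I. cmod (z j)) =
      ennreal (\<Prod>k\<in>?I. d k) * (H (\<lambda>j\<in>?I. cmod (z j)) *
      ennreal (\<Prod>j\<in>?I. cmod (z j) ^ (2 * \<sigma> (j - 1)) * exp (- real n * V (cmod (z j)))))"
      by (simp only: mult_ac)
  qed
  also have "\<dots> = ennreal (\<Prod>k\<in>?I. d k) * (\<integral>\<^sup>+z. H (\<lambda>j\<in>?I. cmod (z j)) *
      ennreal (\<Prod>j\<in>?I. cmod (z j) ^ (2 * \<sigma> (j - 1)) * exp (- real n * V (cmod (z j)))) \<partial>?L)"
    by (rule nn_integral_cmult) measurable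
  finally show ?thesis .
qed

section \<open>Equality in law for symmetric functionals\<close>

lemma emeasure_distr_nn_integral:
  assumes "X \<in> measurable M N" "A \<in> sets N"
  shows "emeasure (distr M N X) A = (\<integral>\<^sup>+\<omega>. indicator A (X \<omega>) \<partial>M)"
proof -
  have "emeasure (distr M N X) A = (\<integral>\<^sup>+x. indicator A x \<partial>distr M N X)"
    using assms by (intro nn_integral_indicator[symmetric]) simp
  also have "\<dots> = (\<integral>\<^sup>+\<omega>. indicator A (X \<omega>) \<partial>M)"
    using assms by (intro nn_integral_distr) simp_all
  finally show ?thesis .
qed

text \<open>\<open>F\<close> stands for the decreasing reordering or the point process: by
  \<open>F_cong\<close> it reads the coordinates \<open>1..n\<close>, by \<open>F_perm\<close> it is
  symmetric. Indicators composed with \<open>F\<close> are then admissible test functions in the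
  integral identities.\<close>

lemma symmetric_eq_in_distr:
  fixes V :: "real \<Rightarrow> real" and n :: nat
    and P :: "'v measure" and Z :: "nat \<Rightarrow> 'v \<Rightarrow> complex"
    and P' :: "'w measure" and R :: "nat \<Rightarrow> 'w \<Rightarrow> real"
  assumes cont: "continuous_on UNIV (\<lambda>z::complex. V (cmod z))"
    and n: "n \<ge> 1"
    and P: "prob_space P"
    and Z: "has_density_prop_to P (\<Pi>\<^sub>M j\<in>{1..n}. lborel) (\<lambda>\<omega>. \<lambda>j\<in>{1..n}. Z j \<omega>) (gas_weight V n)"
    and P': "prob_space P'"
    and R_indep: "prob_space.indep_vars P' (\<lambda>_. borel) R {1..n}"
    and R: "\<And>k. k \<in> {1..n} \<Longrightarrow> has_density_prop_to P' lborel (R k) (radial_weight V n k)"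
    and F: "F \<in> measurable (\<Pi>\<^sub>M j\<in>{1..n}. borel) S"
    and F_cong: "\<And>x y. (\<And>j. j \<in> {1..n} \<Longrightarrow> x j = y j) \<Longrightarrow> F x = F y"
    and F_perm: "\<And>\<tau> x. bij_betw \<tau> {1..n} {1..n} \<Longrightarrow> F (\<lambda>j. x (\<tau> j)) = F x"
  shows "eq_in_distr P P' S (\<lambda>\<omega>. F (\<lambda>k. cmod (Z k \<omega>))) (\<lambda>\<omega>. F (\<lambda>k. R k \<omega>))"
proof -
  let ?I = "{1..n}" and ?S = "{\<sigma>. \<sigma> permutes {0..<n}}"
  let ?L = "\<Pi>\<^sub>M j\<in>?I. lborel :: complex measure"
  interpret P: prob_space P by fact
  interpret P': prob_space P' by fact
  have V[measurable]: "(\<lambda>z. V (cmod z)) \<in> borel_measurable borel"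
    using cont by (rule borel_measurable_continuous_onI)
  obtain c where c: "c > 0" and Z_dist: "distributed P ?L (\<lambda>\<omega>. \<lambda>j\<in>?I. Z j \<omega>) (\<lambda>z. ennreal (c * gas_weight V n z))"
    using Z by (auto simp: has_density_prop_to_def)
  have "\<exists>c>0. distributed P' lborel (R k) (\<lambda>t. ennreal (c * radial_weight V n k t))" if "k \<in> ?I" for k
    using R[OF that] by (simp add: has_density_prop_to_def)
  then obtain b where b: "\<And>k. k \<in> ?I \<Longrightarrow> b k > 0"
    "\<And>k. k \<in> ?I \<Longrightarrow> distributed P' lborel (R k) (\<lambda>t. ennreal (b k * radial_weight V n k t))"
    by metis
  have R_meas[measurable]: "R k \<in> borel_measurable P'" if "k \<in> ?I" for k
    using distributed_measurable[OF b(2)[OF that]] by simp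
  have Z_meas: "(\<lambda>\<omega>. \<lambda>j\<in>?I. Z j \<omega>) \<in> measurable P ?L"
    using Z_dist by (rule distributed_measurable)
  define \<mu> where "\<mu> k = distr P' borel (R k)" for k
  \<comment> \<open>The constant of \<open>R k\<close> with the \<open>2 * pi\<close> of the polar
    Jacobian split off, as in \<open>distr_radial_law\<close>.\<close>
  define d where "d k = b k / (2 * pi)" for k
  define D where "D = (\<Prod>k\<in>?I. d k)"
  have d: "d k > 0" if "k \<in> ?I" for k
    using b(1)[OF that] by (simp add: d_def)
  have D: "D > 0" unfolding D_def by (intro prod_pos d)
  \<comment> \<open>Independence read as a product law; \<open>n\<close> makes the index set
    nonempty.\<close>
  have R_law: "distr P' (\<Pi>\<^sub>M j\<in>?I. borel) (\<lambda>\<omega>. \<lambda>j\<in>?I. R j \<omega>) = PiM ?I \<mu>"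
    using P'.indep_vars_iff_distr_eq_PiM'[where I = ?I and M' = "\<lambda>_. borel" and X = R] R_indep n R_meas by (auto simp: \<mu>_def[abs_def])
  have R_vec[measurable]: "(\<lambda>\<omega>. \<lambda>j\<in>?I. R j \<omega>) \<in> measurable P' (\<Pi>\<^sub>M j\<in>?I. borel)"
    using R_meas by (intro measurable_restrict)
  have mod_vec: "(\<lambda>\<omega>. \<lambda>j\<in>?I. cmod (Z j \<omega>)) \<in> measurable P (\<Pi>\<^sub>M j\<in>?I. borel)"
  proof (rule measurable_restrict)
    fix j assume j: "j \<in> ?I"
    \<comment> \<open>The density hypothesis makes the whole vector measurable, and each coordinate
      is recovered by projection.\<close>
    have "(\<lambda>\<omega>. cmod ((\<lambda>j\<in>?I. Z j \<omega>) j)) \<in> borel_measurable P"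
      by (rule measurable_compose[OF Z_meas]) (use j in measurable)
    then show "(\<lambda>\<omega>. cmod (Z j \<omega>)) \<in> borel_measurable P" using j by simp
  qed
  \<comment> \<open>The averaged weight has one term for each of the \<open>fact n\<close>
    permutations, and each term yields the same integral over the radii. The constants of the gas
    and of the radii enter through \<open>c\<close> and \<open>D\<close>.\<close>
  have main: "ennreal c * of_nat (fact n) * (\<integral>\<^sup>+\<omega>. H (\<lambda>j\<in>?I. R j \<omega>) \<partial>P') =
      ennreal D * (\<integral>\<^sup>+\<omega>. H (\<lambda>j\<in>?I. cmod (Z j \<omega>)) \<partial>P)"
    if H[measurable]: "H \<in> borel_measurable (\<Pi>\<^sub>M j\<in>?I. borel)"
      and sym: "\<And>\<tau> x. bij_betw \<tau> ?I ?I \<Longrightarrow> H (\<lambda>j\<in>?I. x (\<tau> j)) = H (\<lambda>j\<in>?I. x j)" for H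
  proof -
    let ?h = "\<lambda>z :: nat \<Rightarrow> complex. H (\<lambda>j\<in>?I. cmod (z j))"
    let ?w = "\<lambda>\<sigma> z. \<Prod>j\<in>?I. cmod (z j) ^ (2 * \<sigma> (j - 1)) * exp (- real n * V (cmod (z j)))"
    have w_nonneg: "?w \<sigma> z \<ge> 0" for \<sigma> :: "nat \<Rightarrow> nat" and z :: "nat \<Rightarrow> complex"
      by (intro prod_nonneg) auto
    have "(\<integral>\<^sup>+\<omega>. H (\<lambda>j\<in>?I. R j \<omega>) \<partial>P') = (\<integral>\<^sup>+x. H x \<partial>PiM ?I \<mu>)"
      unfolding R_law[symmetric] by (rule nn_integral_distr[symmetric]) measurable
    then have "of_nat (fact n) * (\<integral>\<^sup>+\<omega>. H (\<lambda>j\<in>?I. R j \<omega>) \<partial>P') = of_nat (fact n) * (\<integral>\<^sup>+x. H x \<partial>PiM ?I \<mu>)"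
      by (simp only:)
    also have "\<dots> = (\<Sum>\<sigma>\<in>?S. \<integral>\<^sup>+x. H x \<partial>PiM ?I \<mu>)"
      by (simp add: card_permutations[of _ n])
    also have "\<dots> = (\<Sum>\<sigma>\<in>?S. ennreal D * (\<integral>\<^sup>+z. ?h z * ennreal (?w \<sigma> z) \<partial>?L))"
    proof (rule sum.cong[OF refl])
      fix \<sigma> assume "\<sigma> \<in> ?S"
      then show "(\<integral>\<^sup>+x. H x \<partial>PiM ?I \<mu>) = ennreal D * (\<integral>\<^sup>+z. ?h z * ennreal (?w \<sigma> z) \<partial>?L)"
        unfolding D_def
      proof (intro nn_integral_PiM_radial_perm V d H sym)
        fix k assume k: "k \<in> ?I"
        show "\<mu> k = distr (density lborel (\<lambda>z. ennreal
            (d k * (cmod z ^ (2 * (k - 1)) * exp (- real n * V (cmod z)))))) borel cmod"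
          unfolding \<mu>_def d_def using k by (intro distr_radial_law cont b) auto
        show "prob_space (\<mu> k)"
          unfolding \<mu>_def by (rule P'.prob_space_distr[OF R_meas[OF k]])
      qed auto
    qed
    also have "\<dots> = ennreal D * (\<Sum>\<sigma>\<in>?S. \<integral>\<^sup>+z. ?h z * ennreal (?w \<sigma> z) \<partial>?L)"
      by (rule sum_distrib_left[symmetric])
    also have "(\<Sum>\<sigma>\<in>?S. \<integral>\<^sup>+z. ?h z * ennreal (?w \<sigma> z) \<partial>?L) =
        (\<integral>\<^sup>+z. (\<Sum>\<sigma>\<in>?S. ?h z * ennreal (?w \<sigma> z)) \<partial>?L)"
      by (rule nn_integral_sum[symmetric]) measurable
    also have "\<dots> = (\<integral>\<^sup>+z. ?h z * ennreal (\<Sum>\<sigma>\<in>?S. ?w \<sigma> z) \<partial>?L)"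
      by (simp only: sum_ennreal w_nonneg flip: sum_distrib_left)
    also have "\<dots> = (\<integral>\<^sup>+z. ?h z * ennreal (gas_weight V n z) \<partial>?L)"
      by (simp only: nn_integral_gas_weight[OF V H n])
    finally have "ennreal c * of_nat (fact n) * (\<integral>\<^sup>+\<omega>. H (\<lambda>j\<in>?I. R j \<omega>) \<partial>P') =
        ennreal D * (ennreal c * (\<integral>\<^sup>+z. ?h z * ennreal (gas_weight V n z) \<partial>?L))"
      by (simp only: mult_ac)
    also have "ennreal c * (\<integral>\<^sup>+z. ?h z * ennreal (gas_weight V n z) \<partial>?L) =
        (\<integral>\<^sup>+z. ennreal c * (?h z * ennreal (gas_weight V n z)) \<partial>?L)"
      by (rule nn_integral_cmult[symmetric]) measurable
    also have "\<dots> = (\<integral>\<^sup>+z. ennreal (c * gas_weight V n z) * ?h z \<partial>?L)"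
      using c by (simp add: ennreal_mult' mult_ac)
    also have "\<dots> = (\<integral>\<^sup>+\<omega>. ?h (\<lambda>j\<in>?I. Z j \<omega>) \<partial>P)"
      by (rule distributed_nn_integral[OF Z_dist]) measurable
    also have "\<dots> = (\<integral>\<^sup>+\<omega>. H (\<lambda>j\<in>?I. cmod (Z j \<omega>)) \<partial>P)"
      by (simp cong: restrict_cong)
    finally show ?thesis .
  qed
  txt \<open>The normalizing constants are compared by testing with \<open>H = 1\<close>.\<close>
  have const: "ennreal c * of_nat (fact n) = ennreal D"
    using main[of "\<lambda>_. 1"] by (simp add: P.emeasure_space_1 P'.emeasure_space_1)
  have F_Z: "F (\<lambda>k. cmod (Z k \<omega>)) = F (\<lambda>j\<in>?I. cmod (Z j \<omega>))" for \<omega>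
    by (rule F_cong) simp
  have F_R: "F (\<lambda>k. R k \<omega>) = F (\<lambda>j\<in>?I. R j \<omega>)" for \<omega>
    by (rule F_cong) simp
  have meas: "(\<lambda>\<omega>. F (\<lambda>k. cmod (Z k \<omega>))) \<in> measurable P S" "(\<lambda>\<omega>. F (\<lambda>k. R k \<omega>)) \<in> measurable P' S"
    unfolding F_Z F_R by (rule measurable_compose[OF _ F], fact)+
  have "distr P S (\<lambda>\<omega>. F (\<lambda>k. cmod (Z k \<omega>))) = distr P' S (\<lambda>\<omega>. F (\<lambda>k. R k \<omega>))"
  proof (rule measure_eqI)
    fix A assume "A \<in> sets (distr P S (\<lambda>\<omega>. F (\<lambda>k. cmod (Z k \<omega>))))"
    then have A[measurable]: "A \<in> sets S" by simp
    let ?H = "\<lambda>x. indicator A (F x) :: ennreal"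
    have H: "?H \<in> borel_measurable (\<Pi>\<^sub>M j\<in>?I. borel)"
      using F by measurable
    have sym: "?H (\<lambda>j\<in>?I. x (\<tau> j)) = ?H (\<lambda>j\<in>?I. x j)" if "bij_betw \<tau> ?I ?I" for \<tau> x
    proof -
      have "F (\<lambda>j\<in>?I. x (\<tau> j)) = F (\<lambda>j. x (\<tau> j))" by (rule F_cong) simp
      also have "\<dots> = F x" by (rule F_perm[OF that])
      also have "\<dots> = F (\<lambda>j\<in>?I. x j)" by (rule F_cong) simp
      finally show ?thesis by (rule arg_cong)
    qed
    have "ennreal D * (\<integral>\<^sup>+\<omega>. ?H (\<lambda>j\<in>?I. R j \<omega>) \<partial>P') = ennreal D * (\<integral>\<^sup>+\<omega>. ?H (\<lambda>j\<in>?I. cmod (Z j \<omega>)) \<partial>P)"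
      using main[OF H sym] by (simp only: const)
    then have "(\<integral>\<^sup>+\<omega>. ?H (\<lambda>k. R k \<omega>) \<partial>P') = (\<integral>\<^sup>+\<omega>. ?H (\<lambda>k. cmod (Z k \<omega>)) \<partial>P)"
      unfolding F_Z F_R using D by (simp add: ennreal_mult_cancel_left)
    then show "emeasure (distr P S (\<lambda>\<omega>. F (\<lambda>k. cmod (Z k \<omega>)))) A =
        emeasure (distr P' S (\<lambda>\<omega>. F (\<lambda>k. R k \<omega>))) A"
      by (simp only: emeasure_distr_nn_integral[OF meas(1) A] emeasure_distr_nn_integral[OF meas(2) A])
  qed simp
  then show ?thesis using meas by (simp add: eq_in_distr_def)
qed

theorem theorem1p2:
  fixes V :: "real \<Rightarrow> real" and n :: nat
    and P :: "'v measure" and Z :: "nat \<Rightarrow> 'v \<Rightarrow> complex"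
    and P' :: "'w measure" and R :: "nat \<Rightarrow> 'w \<Rightarrow> real"
  assumes V_smooth: "smooth_on {0..} V"
    and Q_smooth: "smooth_on UNIV (\<lambda>z::complex. V (cmod z))"
    and V_shape: "mono_on {0..} (\<lambda>r. r * deriv V r) \<or> convex_on {0..} V"
    and V_growth: "((\<lambda>r. r\<^sup>2 * exp (- V r)) \<longlongrightarrow> 0) at_top"
    and V_bound: "\<exists>\<beta>'>2. bdd_above (range (\<lambda>z::complex. (1 + cmod z) powr \<beta>' * exp (- V (cmod z))))"
    and n: "n \<ge> 1"
    and weight_integrable: "integrable (\<Pi>\<^sub>M j\<in>{1..n}. lborel) (gas_weight V n)"
    and P: "prob_space P"
    and Z_density: "has_density_prop_to P (\<Pi>\<^sub>M j\<in>{1..n}. lborel)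
      (\<lambda>\<omega>. \<lambda>j\<in>{1..n}. Z j \<omega>) (gas_weight V n)"
    and P': "prob_space P'"
    and R_indep: "prob_space.indep_vars P' (\<lambda>_. borel) R {1..n}"
    and R_density: "\<And>k. k \<in> {1..n} \<Longrightarrow> has_density_prop_to P' lborel (R k) (radial_weight V n k)"
  shows "eq_in_distr P P' (\<Pi>\<^sub>M k\<in>{1..n}. borel)
      (\<lambda>\<omega>. decreasing_reordering n (\<lambda>k. cmod (Z k \<omega>)))
      (\<lambda>\<omega>. decreasing_reordering n (\<lambda>k. R k \<omega>)) \<and>
    eq_in_distr P P' (measure_algebra borel)
      (\<lambda>\<omega>. dirac_sum n (\<lambda>k. cmod (Z k \<omega>)))
      (\<lambda>\<omega>. dirac_sum n (\<lambda>k. R k \<omega>))"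
proof -
  \<comment> \<open>Order zero of smoothness is continuity, which makes \<open>V (cmod z)\<close>
    measurable.\<close>
  have cont: "continuous_on UNIV (\<lambda>z::complex. V (cmod z))"
    using Q_smooth Ck_on.simps(1) unfolding smooth_on_def by blast
  \<comment> \<open>The two conclusions are the instances of \<open>F\<close> given by
    \<open>decreasing_reordering n\<close> and \<open>dirac_sum n\<close>.\<close>
  note symmetric_eq = symmetric_eq_in_distr[OF cont n P Z_density P' R_indep R_density]
  show ?thesis
    by (intro conjI symmetric_eq measurable_decreasing_reordering measurable_dirac_sum
        decreasing_reordering_cong decreasing_reordering_perm dirac_sum_cong dirac_sum_perm)
qed

end
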